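(* Let $G$ be a Lie group with left-invariant Haar measure $dm$ and modular function $\Delta$, let $1\le p<\infty$ and $f,g\in L^p(G)$. Then $$\int_{G\times G}|g(x^{-1}y)f(x)-g(y^{-1}x)f(y)|^p\,dm(x)\,dm(y)\ \ge\ \int_G\big|\,|g(y)|-\Delta(y)^{-1/p}|g(y^{-1})|\,\big|^p\,dm(y)\int_G|f(x)|^p\,dm(x).$$
   Context: The modular function is normalized by $m(Eg)=\Delta(g)\,m(E)$ for measurable $E\subset G$ and $g\in G$, where $m$ is the left-invariant Haar measure. $L^p(G)$ is taken with respect to $m$. *)

theory Defs
  imports "HOL-Analysis.Analysis" "HOL-Algebra.Coset"
begin

text \<open>
  Points of real n-space are the points of \<^term>\<open>Euclidean_space n\<close>: sequences
  \<^typ>\<open>nat \<Rightarrow> real\<close> that vanish from index n on. In contrast to a type of class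
  euclidean_space, this lets n be an ordinary natural number and includes n = 0.
\<close>

text \<open>
  Here S is meant to be open in \<^term>\<open>Euclidean_space n\<close>, so that \<^term>\<open>x(i := t)\<close> lies in S
  for t near \<^term>\<open>x i\<close> and values of f outside S are irrelevant.
\<close>

primrec C_on :: "nat \<Rightarrow> nat \<Rightarrow> (nat \<Rightarrow> real) set \<Rightarrow> ((nat \<Rightarrow> real) \<Rightarrow> real) \<Rightarrow> bool" where
  "C_on n 0 S f \<longleftrightarrow> continuous_map (subtopology (Euclidean_space n) S) euclideanreal f"
| "C_on n (Suc k) S f \<longleftrightarrow>
     continuous_map (subtopology (Euclidean_space n) S) euclideanreal f \<and>
     (\<forall>i<n. \<exists>f'. (\<forall>x\<in>S. ((\<lambda>t. f (x(i := t))) has_real_derivative f' x) (at (x i))) \<and>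
                 C_on n k S f')"

definition smooth_on_Euclidean ::
    "nat \<Rightarrow> nat \<Rightarrow> (nat \<Rightarrow> real) set \<Rightarrow> ((nat \<Rightarrow> real) \<Rightarrow> nat \<Rightarrow> real) \<Rightarrow> bool" where
  "smooth_on_Euclidean m n S F \<longleftrightarrow> (\<forall>j<n. \<forall>k. C_on m k S (\<lambda>x. F x j))"

type_synonym 'a chart = "'a set \<times> ('a \<Rightarrow> nat \<Rightarrow> real)"

definition smooth_atlas :: "'a topology \<Rightarrow> nat \<Rightarrow> 'a chart set \<Rightarrow> bool" where
  "smooth_atlas X n A \<longleftrightarrow>
     (\<Union>(U, \<phi>)\<in>A. U) = topspace X \<and>
     (\<forall>(U, \<phi>)\<in>A. openin X U \<and> openin (Euclidean_space n) (\<phi> ` U) \<and>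
        homeomorphic_map (subtopology X U) (subtopology (Euclidean_space n) (\<phi> ` U)) \<phi>) \<and>
     (\<forall>(U, \<phi>)\<in>A. \<forall>(V, \<psi>)\<in>A.
        smooth_on_Euclidean n n (\<phi> ` (U \<inter> V)) (\<lambda>v. \<psi> (inv_into U \<phi> v)))"

definition smooth_manifold :: "'a topology \<Rightarrow> nat \<Rightarrow> 'a chart set \<Rightarrow> bool" where
  "smooth_manifold X n A \<longleftrightarrow>
     Hausdorff_space X \<and> second_countable X \<and> smooth_atlas X n A"

text \<open>Coordinates of an m-dimensional and a further chart are concatenated.\<close>

definition product_atlas :: "nat \<Rightarrow> 'a chart set \<Rightarrow> 'b chart set \<Rightarrow> ('a \<times> 'b) chart set" where
  "product_atlas m A B =
     {(U \<times> V, \<lambda>(x, y) i. if i < m then \<phi> x i else \<psi> y (i - m)) |U \<phi> V \<psi>.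
        (U, \<phi>) \<in> A \<and> (V, \<psi>) \<in> B}"

definition smooth_map :: "'a topology \<Rightarrow> nat \<Rightarrow> 'a chart set \<Rightarrow>
    'b topology \<Rightarrow> nat \<Rightarrow> 'b chart set \<Rightarrow> ('a \<Rightarrow> 'b) \<Rightarrow> bool" where
  "smooth_map X m A Y n B F \<longleftrightarrow>
     continuous_map X Y F \<and>
     (\<forall>(U, \<phi>)\<in>A. \<forall>(V, \<psi>)\<in>B.
        smooth_on_Euclidean m n (\<phi> ` {x \<in> U. F x \<in> V}) (\<lambda>v. \<psi> (F (inv_into U \<phi> v))))"

definition lie_group ::
    "('a, 'b) monoid_scheme \<Rightarrow> 'a topology \<Rightarrow> nat \<Rightarrow> 'a chart set \<Rightarrow> bool" where
  "lie_group G X n A \<longleftrightarrow>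
     group G \<and> topspace X = carrier G \<and> smooth_manifold X n A \<and>
     smooth_map (prod_topology X X) (n + n) (product_atlas n A A) X n A
       (\<lambda>(x, y). x \<otimes>\<^bsub>G\<^esub> y) \<and>
     smooth_map X n A X n A (\<lambda>x. inv\<^bsub>G\<^esub> x)"

text \<open>
  A nonzero, left-invariant Borel measure that is finite on compact sets. Regularity is not
  required separately: it is automatic on second countable locally compact Hausdorff spaces.
\<close>

definition left_haar_measure ::
    "('a, 'b) monoid_scheme \<Rightarrow> 'a topology \<Rightarrow> 'a measure \<Rightarrow> bool" where
  "left_haar_measure G X M \<longleftrightarrow>
     sets M = sets (sigma (topspace X) {U. openin X U}) \<and>
     emeasure M (space M) \<noteq> 0 \<and>
     (\<forall>K. compactin X K \<longrightarrow> emeasure M K < \<infinity>) \<and>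
     (\<forall>a\<in>carrier G. \<forall>E\<in>sets M. emeasure M (a <#\<^bsub>G\<^esub> E) = emeasure M E)"

definition modular_function ::
    "('a, 'b) monoid_scheme \<Rightarrow> 'a measure \<Rightarrow> ('a \<Rightarrow> real) \<Rightarrow> bool" where
  "modular_function G M \<Delta> \<longleftrightarrow>
     (\<forall>a\<in>carrier G. 0 < \<Delta> a \<and>
        (\<forall>E\<in>sets M. emeasure M (E #>\<^bsub>G\<^esub> a) = ennreal (\<Delta> a) * emeasure M E))"

text \<open>Representatives of the classes in complex \<open>L\<^sup>p\<close>, not identified almost everywhere.\<close>

definition Lp_space :: "'a measure \<Rightarrow> real \<Rightarrow> ('a \<Rightarrow> complex) set" where
  "Lp_space M p = {f \<in> borel_measurable M. integrable M (\<lambda>x. cmod (f x) powr p)}"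

end

theory Submission
  imports Defs
begin

text \<open>
  Substituting \<open>y = x \<otimes> z\<close> for fixed \<open>x\<close>, which left invariance permits, and exchanging the order
  of integration turns the double integral into the integral over \<open>z\<close> of
  \<open>\<integral> |g z * f x - g (inv z) * f (x \<otimes> z)|\<^sup>p dx\<close>. For fixed \<open>z\<close> this is the \<open>p\<close>-th power of the
  \<open>L\<^sup>p\<close> distance between a multiple of \<open>f\<close> and a multiple of a right translate of \<open>f\<close>. Right translation
  by \<open>z\<close> multiplies the \<open>L\<^sup>p\<close> norm by \<open>\<Delta> z powr (- 1 / p)\<close>, so the two norms are
  \<open>|g z| * \<parallel>f\<parallel>\<close> and \<open>\<Delta> z powr (- 1 / p) * |g (inv z)| * \<parallel>f\<parallel>\<close>, and the distance is at least
  the difference of the norms (\<open>nn_integral_reverse_Minkowski\<close>). Integrating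
  this slicewise bound (\<open>twisted_commutator_slice\<close>) over \<open>z\<close> gives the theorem.

  The integral estimates are carried out for a group with a nonzero \<open>\<sigma>\<close>-finite left-invariant measure
  for which multiplication and inversion are measurable. A Lie group provides this structure: charts
  make it locally compact, so that second countability yields countably many open sets of finite
  measure covering the group. Second countability also makes every open subset of the product a
  countable union of open rectangles, which is what makes multiplication measurable for the product of the Borel \<open>\<sigma>\<close>-algebras.
\<close>

section \<open>The reverse triangle inequality in \<open>L\<^sup>p\<close>\<close>

text \<open>
  Convexity of \<open>t powr p\<close> at \<open>a / A\<close> and \<open>b / B\<close> with weights \<open>A / (A + B)\<close> and \<open>B / (A + B)\<close>. With
  \<open>A\<close> and \<open>B\<close> the norms of two functions, integrating this bound gives Minkowski's inequality
  without passing through Hoelder's.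
\<close>

lemma powr_weighted_mean:
  fixes a b A B p :: real
  assumes "1 \<le> p" "0 \<le> a" "0 \<le> b" "0 < A" "0 < B"
  shows "(a + b) powr p \<le> (A + B) powr (p - 1) * (A powr (1 - p) * a powr p + B powr (1 - p) * b powr p)"
proof -
  \<comment> \<open>The convexity argument is run on positive \<open>a\<close> and \<open>b\<close>; this bound covers a vanishing one.\<close>
  have scaled: "c powr p \<le> (A + B) powr (p - 1) * (C powr (1 - p) * c powr p)"
    if "0 < C" "C \<le> A + B" for c C
  proof -
    have "1 \<le> ((A + B) / C) powr (p - 1)"
      using that assms by (intro ge_one_powr_ge_zero) auto
    also have "\<dots> = (A + B) powr (p - 1) * C powr (1 - p)"
      using that assms powr_minus_divide[of C "p - 1"] by (simp add: powr_divide)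
    finally show ?thesis
      using mult_right_mono[of 1 "(A + B) powr (p - 1) * C powr (1 - p)" "c powr p"]
      by (simp add: mult.assoc)
  qed
  consider "a = 0" | "b = 0" | "0 < a" "0 < b" using assms by linarith
  then show ?thesis
  proof cases
    case 1 then show ?thesis using scaled[of B b] assms by simp
  next
    case 2 then show ?thesis using scaled[of A a] assms by simp
  next
    case 3
    define t where "t = B / (A + B)"
    have t: "0 \<le> t" "t \<le> 1" "1 - t = A / (A + B)" using assms by (auto simp: t_def field_simps)
    have "((1 - t) *\<^sub>R (a / A) + t *\<^sub>R (b / B)) powr p
        \<le> (1 - t) * (a / A) powr p + t * (b / B) powr p"
      using convex_onD[OF powr_convex[OF assms(1)] t(1,2), of "a / A" "b / B"] 3 assms by simp
    also have "(1 - t) *\<^sub>R (a / A) + t *\<^sub>R (b / B) = (a + b) / (A + B)"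
      using assms by (simp add: t(3)) (simp add: t_def add_divide_distrib)
    finally have "(a + b) powr p / (A + B) powr p
        \<le> A / (A + B) * (a powr p / A powr p) + B / (A + B) * (b powr p / B powr p)"
      using 3 assms unfolding t(3) by (simp add: t_def powr_divide)
    also have "\<dots> = (A * (a powr p / A powr p) + B * (b powr p / B powr p)) / (A + B)"
      by (simp add: add_divide_distrib mult.commute)
    finally have "(a + b) powr p / (A + B) powr p
        \<le> (A * (a powr p / A powr p) + B * (b powr p / B powr p)) / (A + B)" .
    then have "(a + b) powr p
        \<le> (A + B) powr p / (A + B) * (A * (a powr p / A powr p) + B * (b powr p / B powr p))"
      using assms by (simp add: field_simps)
    also have "\<dots> = (A + B) powr (p - 1) * (A powr (1 - p) * a powr p + B powr (1 - p) * b powr p)"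
      using assms by (simp add: powr_diff)
    finally show ?thesis .
  qed
qed

lemma nn_integral_Minkowski:
  fixes u v :: "'a \<Rightarrow> 'b :: {real_normed_vector, second_countable_topology}"
  assumes p: "1 \<le> p" and [measurable]: "u \<in> borel_measurable M" "v \<in> borel_measurable M"
    and pos: "0 < A" "0 < B"
    and u: "(\<integral>\<^sup>+x. ennreal (norm (u x) powr p) \<partial>M) \<le> ennreal (A powr p)"
    and v: "(\<integral>\<^sup>+x. ennreal (norm (v x) powr p) \<partial>M) \<le> ennreal (B powr p)"
  shows "(\<integral>\<^sup>+x. ennreal (norm (u x + v x) powr p) \<partial>M) \<le> ennreal ((A + B) powr p)"
proof -
  define k where "k C = (A + B) powr (p - 1) * C powr (1 - p)" for C
  have k0: "0 \<le> k C" for C by (simp add: k_def)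
  have "(\<integral>\<^sup>+x. ennreal (norm (u x + v x) powr p) \<partial>M)
      \<le> (\<integral>\<^sup>+x. ennreal (k A) * ennreal (norm (u x) powr p) + ennreal (k B) * ennreal (norm (v x) powr p) \<partial>M)"
  proof (rule nn_integral_mono)
    fix x
    have "norm (u x + v x) powr p \<le> (norm (u x) + norm (v x)) powr p"
      using p by (intro powr_mono2) (auto simp: norm_triangle_ineq)
    also have "\<dots> \<le> k A * norm (u x) powr p + k B * norm (v x) powr p"
      using powr_weighted_mean[OF p, of "norm (u x)" "norm (v x)" A B] pos
      by (simp add: k_def distrib_left mult.assoc)
    finally show "ennreal (norm (u x + v x) powr p) \<le>
        ennreal (k A) * ennreal (norm (u x) powr p) + ennreal (k B) * ennreal (norm (v x) powr p)"
      by (simp add: k0 flip: ennreal_mult ennreal_plus)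
  qed
  also have "\<dots> = ennreal (k A) * (\<integral>\<^sup>+x. ennreal (norm (u x) powr p) \<partial>M)
                + ennreal (k B) * (\<integral>\<^sup>+x. ennreal (norm (v x) powr p) \<partial>M)"
    by (simp add: nn_integral_add nn_integral_cmult)
  also have "\<dots> \<le> ennreal (k A) * ennreal (A powr p) + ennreal (k B) * ennreal (B powr p)"
    by (intro add_mono mult_left_mono u v) auto
  also have "\<dots> = ennreal ((A + B) powr (p - 1) * (A + B))"
    using pos by (simp add: k0 flip: ennreal_mult ennreal_plus)
      (simp add: k_def mult.assoc distrib_left flip: powr_add)
  also have "(A + B) powr (p - 1) * (A + B) = (A + B) powr p"
    using pos by (simp add: powr_diff)
  finally show ?thesis .
qed

text \<open>
  If \<open>u - v\<close> had norm less than \<open>A - B\<close>, Minkowski's inequality for \<open>u = (u - v) + v\<close> would bound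
  the norm of \<open>u\<close> by something less than \<open>A\<close>.
\<close>

lemma nn_integral_reverse_Minkowski_less:
  fixes u v :: "'a \<Rightarrow> 'b :: {real_normed_vector, second_countable_topology}"
  assumes p: "1 \<le> p" and [measurable]: "u \<in> borel_measurable M" "v \<in> borel_measurable M"
    and AB: "0 \<le> B" "B < A"
    and u: "(\<integral>\<^sup>+x. ennreal (norm (u x) powr p) \<partial>M) = ennreal (A powr p)"
    and v: "(\<integral>\<^sup>+x. ennreal (norm (v x) powr p) \<partial>M) = ennreal (B powr p)"
  shows "ennreal ((A - B) powr p) \<le> (\<integral>\<^sup>+x. ennreal (norm (u x - v x) powr p) \<partial>M)"
proof (rule ccontr)
  assume "\<not> ?thesis"
  then have less: "(\<integral>\<^sup>+x. ennreal (norm (u x - v x) powr p) \<partial>M) < ennreal ((A - B) powr p)"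
    by simp
  then obtain c where c: "0 \<le> c" "(\<integral>\<^sup>+x. ennreal (norm (u x - v x) powr p) \<partial>M) = ennreal c"
    by (cases "\<integral>\<^sup>+x. ennreal (norm (u x - v x) powr p) \<partial>M") (auto simp: top_unique)
  with less have "c < (A - B) powr p" by (simp add: ennreal_less_iff)
  then have "c powr (1 / p) < ((A - B) powr p) powr (1 / p)"
    using c p by (intro powr_less_mono2) auto
  then have cD: "c powr (1 / p) < A - B" using p AB by (simp add: powr_powr)
  define D where "D = max (c powr (1 / p)) ((A - B) / 2)"
  have D: "0 < D" "D < A - B" using cD AB by (auto simp: D_def less_max_iff_disj)
  \<comment> \<open>The norms of \<open>v\<close> and \<open>u - v\<close> may vanish, hence strictly larger bounds with sum below \<open>A\<close>.\<close>
  define B' where "B' = (A - D + B) / 2"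
  have B': "B < B'" "0 < B'" "D + B' < A" using D AB by (auto simp: B'_def field_simps)
  have "c = (c powr (1 / p)) powr p" using c p by (simp add: powr_powr)
  also have "\<dots> \<le> D powr p" using p by (intro powr_mono2) (auto simp: D_def)
  finally have "c \<le> D powr p" .
  then have "(\<integral>\<^sup>+x. ennreal (norm (u x - v x + v x) powr p) \<partial>M) \<le> ennreal ((D + B') powr p)"
    using c v B' AB p D by (intro nn_integral_Minkowski) (auto intro!: ennreal_leI powr_mono2)
  then have "A powr p \<le> (D + B') powr p" by (simp add: u)
  moreover have "(D + B') powr p < A powr p" using D B' p by (intro powr_less_mono2) auto
  ultimately show False by simp
qed

lemma nn_integral_reverse_Minkowski:
  fixes u v :: "'a \<Rightarrow> 'b :: {real_normed_vector, second_countable_topology}"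
  assumes p: "1 \<le> p" and meas: "u \<in> borel_measurable M" "v \<in> borel_measurable M"
    and AB: "0 \<le> A" "0 \<le> B"
    and u: "(\<integral>\<^sup>+x. ennreal (norm (u x) powr p) \<partial>M) = ennreal (A powr p)"
    and v: "(\<integral>\<^sup>+x. ennreal (norm (v x) powr p) \<partial>M) = ennreal (B powr p)"
  shows "ennreal (\<bar>A - B\<bar> powr p) \<le> (\<integral>\<^sup>+x. ennreal (norm (u x - v x) powr p) \<partial>M)"
proof -
  consider "A = B" | "B < A" | "A < B" by linarith
  then show ?thesis
  proof cases
    case 1 then show ?thesis by simp
  next
    case 2 then show ?thesis using nn_integral_reverse_Minkowski_less[OF p meas AB(2) 2 u v] by simp
  next
    case 3 then show ?thesis
      using nn_integral_reverse_Minkowski_less[OF p meas(2,1) AB(1) 3 v u] by (simp add: norm_minus_commute)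
  qed
qed

section \<open>Groups with a left-invariant measure\<close>

locale left_invariant_measure = group G + sigma_finite_measure M
  for G :: "('a, 'b) monoid_scheme" (structure) and M :: "'a measure" +
  assumes space_carrier: "space M = carrier G"
    and mult_measurable: "(\<lambda>(x, y). x \<otimes> y) \<in> measurable (M \<Otimes>\<^sub>M M) M"
    and inv_measurable [measurable]: "(\<lambda>x. inv x) \<in> measurable M M"
    and left_invariant: "a \<in> carrier G \<Longrightarrow> E \<in> sets M \<Longrightarrow> emeasure M (a <# E) = emeasure M E"
    and nonzero: "emeasure M (space M) \<noteq> 0"
begin

lemma measurable_mult [measurable (raw)]:
  assumes "h \<in> measurable N M" "k \<in> measurable N M"
  shows "(\<lambda>x. h x \<otimes> k x) \<in> measurable N M"
  using measurable_compose[OF measurable_Pair[OF assms] mult_measurable] by simp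

lemma sets_subset_carrier: "E \<in> sets M \<Longrightarrow> E \<subseteq> carrier G"
  using sets.sets_into_space space_carrier by auto

lemma measurable_left_translate:
  assumes "a \<in> carrier G" shows "(\<lambda>x. a \<otimes> x) \<in> measurable M M"
  using assms space_carrier by (intro measurable_mult) auto

lemma measurable_right_translate:
  assumes "a \<in> carrier G" shows "(\<lambda>x. x \<otimes> a) \<in> measurable M M"
  using assms space_carrier by (intro measurable_mult) auto

lemma nn_integral_left_translate:
  assumes a: "a \<in> carrier G" and h: "h \<in> borel_measurable M"
  shows "(\<integral>\<^sup>+x. h (a \<otimes> x) \<partial>M) = (\<integral>\<^sup>+x. h x \<partial>M)"
proof -
  note [measurable] = measurable_left_translate[OF a]
  have "distr M M (\<lambda>x. a \<otimes> x) = M"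
  proof (rule measure_eqI)
    fix E assume "E \<in> sets (distr M M (\<lambda>x. a \<otimes> x))"
    then have E: "E \<in> sets M" by simp
    have "(\<lambda>x. a \<otimes> x) -` E \<inter> space M = inv a <# E"
      using a sets_subset_carrier[OF E] unfolding space_carrier l_coset_def
      by (auto simp: m_assoc[symmetric] image_iff intro!: bexI[of _ "a \<otimes> _"])
    with E a show "emeasure (distr M M (\<lambda>x. a \<otimes> x)) E = emeasure M E"
      by (simp add: emeasure_distr left_invariant)
  qed simp
  then have "(\<integral>\<^sup>+x. h x \<partial>M) = (\<integral>\<^sup>+x. h x \<partial>distr M M (\<lambda>x. a \<otimes> x))" by simp
  also have "\<dots> = (\<integral>\<^sup>+x. h (a \<otimes> x) \<partial>M)" using h by (simp add: nn_integral_distr)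
  finally show ?thesis by simp
qed

lemma right_translate_vimage:
  assumes a: "a \<in> carrier G" and E: "E \<in> sets M"
  shows "(\<lambda>x. x \<otimes> a) -` E \<inter> space M = E #> inv a"
  using a sets_subset_carrier[OF E] unfolding space_carrier r_coset_def
  by (auto simp: m_assoc image_iff intro!: bexI[of _ "_ \<otimes> a"])

lemma obtain_finite_positive:
  obtains E where "E \<in> sets M" "emeasure M E \<noteq> 0" "emeasure M E \<noteq> \<infinity>"
proof -
  obtain F :: "nat \<Rightarrow> 'a set" where F: "range F \<subseteq> sets M" "(\<Union>i. F i) = space M"
    "\<And>i. emeasure M (F i) \<noteq> \<infinity>"
    using sigma_finite by blast
  have "\<exists>i. emeasure M (F i) \<noteq> 0"
  proof (rule ccontr)
    assume "\<not> ?thesis"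
    then have "emeasure M (\<Union>i. F i) = 0" using F(1) by (intro emeasure_UN_eq_0) auto
    with nonzero F(2) show False by simp
  qed
  with F that show ?thesis by blast
qed

context
  fixes \<Delta> :: "'a \<Rightarrow> real"
  assumes modular: "modular_function G M \<Delta>"
begin

lemma modular_pos: "a \<in> carrier G \<Longrightarrow> 0 < \<Delta> a"
  using modular by (simp add: modular_function_def)

lemma emeasure_right_coset:
  "a \<in> carrier G \<Longrightarrow> E \<in> sets M \<Longrightarrow> emeasure M (E #> a) = ennreal (\<Delta> a) * emeasure M E"
  using modular by (simp add: modular_function_def)

lemma nn_integral_right_translate:
  assumes a: "a \<in> carrier G" and h: "h \<in> borel_measurable M"
  shows "(\<integral>\<^sup>+x. h (x \<otimes> a) \<partial>M) = ennreal (\<Delta> (inv a)) * (\<integral>\<^sup>+x. h x \<partial>M)"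
proof -
  note [measurable] = measurable_right_translate[OF a]
  have "distr M M (\<lambda>x. x \<otimes> a) = scale_measure (ennreal (\<Delta> (inv a))) M"
    by (rule measure_eqI)
      (auto simp: emeasure_distr right_translate_vimage[OF a] emeasure_right_coset a)
  then have "(\<integral>\<^sup>+x. h x \<partial>distr M M (\<lambda>x. x \<otimes> a)) = ennreal (\<Delta> (inv a)) * (\<integral>\<^sup>+x. h x \<partial>M)"
    using h by (simp add: nn_integral_scale_measure)
  then show ?thesis using h by (simp add: nn_integral_distr)
qed

lemma modular_inv:
  assumes a: "a \<in> carrier G"
  shows "\<Delta> (inv a) = 1 / \<Delta> a"
proof -
  obtain E where E: "E \<in> sets M" "emeasure M E \<noteq> 0" "emeasure M E \<noteq> \<infinity>"
    by (rule obtain_finite_positive)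
  have "E #> inv a \<in> sets M"
    using right_translate_vimage[OF a E(1)] measurable_sets[OF measurable_right_translate[OF a] E(1)]
    by simp
  then have "emeasure M (E #> inv a #> a) = ennreal (\<Delta> a) * (ennreal (\<Delta> (inv a)) * emeasure M E)"
    using a E by (simp add: emeasure_right_coset)
  moreover have "E #> inv a #> a = E"
    using a sets_subset_carrier[OF E(1)] by (simp add: coset_mult_assoc)
  moreover obtain m where m: "emeasure M E = ennreal m" "0 < m"
    using E by (cases "emeasure M E") (auto simp: less_le)
  ultimately have "m = \<Delta> a * \<Delta> (inv a) * m"
    using a modular_pos[of a] modular_pos[of "inv a"] by (simp add: mult.assoc flip: ennreal_mult)
  with m modular_pos[OF a] show ?thesis by (simp add: field_simps)
qed

text \<open>
  For a set \<open>E\<close> of finite nonzero measure, \<open>\<Delta> a\<close> is the quotient of the measures of \<open>E #> a\<close> and \<open>E\<close>;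
  by Tonelli's theorem the numerator, an integral of \<open>x \<mapsto> indicator E (x \<otimes> inv a)\<close>, depends measurably
  on \<open>a\<close>.
\<close>

lemma modular_measurable [measurable]: "\<Delta> \<in> borel_measurable M"
proof -
  obtain E where E [measurable]: "E \<in> sets M" and m: "emeasure M E \<noteq> 0" "emeasure M E \<noteq> \<infinity>"
    by (rule obtain_finite_positive)
  have "(\<lambda>a. enn2real ((\<integral>\<^sup>+x. indicator E (x \<otimes> inv a) \<partial>M) / emeasure M E)) \<in> borel_measurable M"
    by measurable
  moreover have "enn2real ((\<integral>\<^sup>+x. indicator E (x \<otimes> inv a) \<partial>M) / emeasure M E) = \<Delta> a"
    if "a \<in> space M" for a
    using that m E nn_integral_right_translate[of "inv a" "indicator E"] modular_pos[of a]
    by (simp add: space_carrier ennreal_mult_divide_eq)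
  ultimately show ?thesis by (simp cong: measurable_cong)
qed

text \<open>
  Left invariance allows the substitution \<open>y = x \<otimes> z\<close> in the inner integral: then \<open>inv x \<otimes> y = z\<close>
  and \<open>inv y \<otimes> x = inv z\<close>, so that \<open>g\<close> no longer depends on \<open>x\<close>.
\<close>

lemma twisted_commutator_substitution:
  fixes f g :: "'a \<Rightarrow> complex"
  assumes [measurable]: "f \<in> borel_measurable M" "g \<in> borel_measurable M"
  shows "(\<integral>\<^sup>+(x, y). ennreal (cmod (g (inv x \<otimes> y) * f x - g (inv y \<otimes> x) * f y) powr p) \<partial>(M \<Otimes>\<^sub>M M))
       = (\<integral>\<^sup>+z. (\<integral>\<^sup>+x. ennreal (cmod (g z * f x - g (inv z) * f (x \<otimes> z)) powr p) \<partial>M) \<partial>M)"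
proof -
  note iterated = nn_integral_fst
  interpret pair_sigma_finite M M ..
  define H where "H x y = ennreal (cmod (g (inv x \<otimes> y) * f x - g (inv y \<otimes> x) * f y) powr p)" for x y
  define K where "K x z = ennreal (cmod (g z * f x - g (inv z) * f (x \<otimes> z)) powr p)" for x z
  have H [measurable]: "case_prod H \<in> borel_measurable (M \<Otimes>\<^sub>M M)" unfolding H_def by measurable
  have K [measurable]: "case_prod K \<in> borel_measurable (M \<Otimes>\<^sub>M M)" unfolding K_def by measurable
  have "(\<integral>\<^sup>+(x, y). H x y \<partial>(M \<Otimes>\<^sub>M M)) = (\<integral>\<^sup>+x. (\<integral>\<^sup>+y. H x y \<partial>M) \<partial>M)"
    using iterated[OF H] by simp
  also have "\<dots> = (\<integral>\<^sup>+x. (\<integral>\<^sup>+z. K x z \<partial>M) \<partial>M)"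
  proof (rule nn_integral_cong)
    fix x assume "x \<in> space M"
    then have x: "x \<in> carrier G" by (simp add: space_carrier)
    then have "(\<integral>\<^sup>+y. H x y \<partial>M) = (\<integral>\<^sup>+z. H x (x \<otimes> z) \<partial>M)"
      using measurable_compose_Pair1[OF _ H, of x]
      by (simp add: space_carrier nn_integral_left_translate)
    also have "\<dots> = (\<integral>\<^sup>+z. K x z \<partial>M)"
      using x by (intro nn_integral_cong)
        (simp add: H_def K_def space_carrier inv_mult_group m_assoc flip: m_assoc[of "inv x"])
    finally show "(\<integral>\<^sup>+y. H x y \<partial>M) = (\<integral>\<^sup>+z. K x z \<partial>M)" .
  qed
  also have "\<dots> = (\<integral>\<^sup>+z. (\<integral>\<^sup>+x. K x z \<partial>M) \<partial>M)"
    using Fubini'[OF K] by simp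
  finally show ?thesis by (simp add: H_def K_def)
qed

text \<open>
  The reverse triangle inequality for \<open>g z * f\<close> and \<open>g (inv z)\<close> times the right translate of \<open>f\<close> by \<open>z\<close>,
  whose norm carries the factor \<open>\<Delta> (inv z) = 1 / \<Delta> z\<close> to the power \<open>1 / p\<close>.
\<close>

lemma twisted_commutator_slice:
  fixes f g :: "'a \<Rightarrow> complex"
  assumes p: "1 \<le> p" and f: "f \<in> Lp_space M p" and z: "z \<in> carrier G"
  shows "ennreal (\<bar>cmod (g z) - \<Delta> z powr (- 1 / p) * cmod (g (inv z))\<bar> powr p)
           * (\<integral>\<^sup>+x. ennreal (cmod (f x) powr p) \<partial>M)
       \<le> (\<integral>\<^sup>+x. ennreal (cmod (g z * f x - g (inv z) * f (x \<otimes> z)) powr p) \<partial>M)"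
proof -
  have [measurable]: "f \<in> borel_measurable M" using f by (simp add: Lp_space_def)
  note [measurable] = measurable_right_translate[OF z]
  define F where "F = (\<integral>x. cmod (f x) powr p \<partial>M)"
  have F0: "0 \<le> F" by (simp add: F_def)
  have F: "(\<integral>\<^sup>+x. ennreal (cmod (f x) powr p) \<partial>M) = ennreal F"
    using f unfolding F_def by (intro nn_integral_eq_integral) (auto simp: Lp_space_def)
  define r where "r = F powr (1 / p)"
  have r: "0 \<le> r" "r powr p = F" using p F0 by (auto simp: r_def powr_powr)
  define d where "d = \<Delta> z powr (- 1 / p)"
  have "d powr p = \<Delta> z powr (- 1)" using p unfolding d_def powr_powr by simp
  then have d: "0 \<le> d" "d powr p = 1 / \<Delta> z"
    using modular_pos[OF z] by (auto simp: d_def powr_minus_divide)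
  have "(\<integral>\<^sup>+x. ennreal (norm (g z * f x) powr p) \<partial>M)
      = ennreal (cmod (g z) powr p) * (\<integral>\<^sup>+x. ennreal (cmod (f x) powr p) \<partial>M)"
    by (simp add: norm_mult powr_mult ennreal_mult nn_integral_cmult)
  then have u: "(\<integral>\<^sup>+x. ennreal (norm (g z * f x) powr p) \<partial>M) = ennreal ((cmod (g z) * r) powr p)"
    using r by (simp add: F powr_mult F0 flip: ennreal_mult)
  have "(\<integral>\<^sup>+x. ennreal (norm (g (inv z) * f (x \<otimes> z)) powr p) \<partial>M)
      = ennreal (cmod (g (inv z)) powr p) * (\<integral>\<^sup>+x. ennreal (cmod (f (x \<otimes> z)) powr p) \<partial>M)"
    by (simp add: norm_mult powr_mult ennreal_mult nn_integral_cmult)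
  also have "\<dots> = ennreal (cmod (g (inv z)) powr p) * (ennreal (1 / \<Delta> z) * ennreal F)"
    using nn_integral_right_translate[OF z, of "\<lambda>x. ennreal (cmod (f x) powr p)"]
    by (simp add: F modular_inv[OF z])
  finally have v: "(\<integral>\<^sup>+x. ennreal (norm (g (inv z) * f (x \<otimes> z)) powr p) \<partial>M)
      = ennreal ((d * cmod (g (inv z)) * r) powr p)"
    using r d modular_pos[OF z] by (simp add: powr_mult F0 mult_ac flip: ennreal_mult)
  have "ennreal (\<bar>cmod (g z) - d * cmod (g (inv z))\<bar> powr p) * ennreal F
      = ennreal (\<bar>cmod (g z) * r - d * cmod (g (inv z)) * r\<bar> powr p)"
    using r F0 by (simp add: abs_mult powr_mult flip: ennreal_mult left_diff_distrib)
  also have "\<dots> \<le> (\<integral>\<^sup>+x. ennreal (norm (g z * f x - g (inv z) * f (x \<otimes> z)) powr p) \<partial>M)"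
    using r d by (intro nn_integral_reverse_Minkowski[OF p _ _ _ _ u v]) auto
  finally show ?thesis by (simp add: F d_def)
qed

lemma twisted_commutator_lower_bound:
  fixes f g :: "'a \<Rightarrow> complex"
  assumes p: "1 \<le> p" and f: "f \<in> Lp_space M p" and g: "g \<in> borel_measurable M"
  shows "(\<integral>\<^sup>+y. ennreal (\<bar>cmod (g y) - \<Delta> y powr (- 1 / p) * cmod (g (inv y))\<bar> powr p) \<partial>M)
         * (\<integral>\<^sup>+x. ennreal (cmod (f x) powr p) \<partial>M)
       \<le> (\<integral>\<^sup>+(x, y). ennreal (cmod (g (inv x \<otimes> y) * f x - g (inv y \<otimes> x) * f y) powr p) \<partial>(M \<Otimes>\<^sub>M M))"
proof -
  have f' [measurable]: "f \<in> borel_measurable M" using f by (simp add: Lp_space_def)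
  note [measurable] = g
  show ?thesis
    unfolding twisted_commutator_substitution[OF f' g]
    by (subst nn_integral_multc[symmetric])
      (auto simp: space_carrier simp del: minus_divide_left
        intro!: nn_integral_mono twisted_commutator_slice[OF p f, simplified])
qed

end

end

section \<open>Haar measure on a Lie group\<close>

lemma smooth_manifold_locally_compact:
  assumes "smooth_manifold X n A"
  shows "locally_compact_space X"
  unfolding locally_compact_space_def
proof
  fix x assume x: "x \<in> topspace X"
  from assms have atlas: "smooth_atlas X n A" by (simp add: smooth_manifold_def)
  with x have "x \<in> (\<Union>(U, \<phi>)\<in>A. U)" by (simp add: smooth_atlas_def)
  then obtain U \<phi> where U: "(U, \<phi>) \<in> A" "x \<in> U" by auto
  with atlas have chart: "openin X U" "openin (Euclidean_space n) (\<phi> ` U)"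
      "homeomorphic_map (subtopology X U) (subtopology (Euclidean_space n) (\<phi> ` U)) \<phi>"
    unfolding smooth_atlas_def by auto
  then have "locally_compact_space (subtopology X U)"
    using locally_compact_space_open_subset[of "Euclidean_space n" "\<phi> ` U"]
      locally_compact_Euclidean_space Hausdorff_Euclidean_space homeomorphic_locally_compact_space
      homeomorphic_map_imp_homeomorphic_space by blast
  moreover have "x \<in> topspace (subtopology X U)" using U x by simp
  ultimately obtain V K where "openin (subtopology X U) V" "compactin (subtopology X U) K"
      "x \<in> V" "V \<subseteq> K"
    unfolding locally_compact_space_def by metis
  then show "\<exists>V K. openin X V \<and> compactin X K \<and> x \<in> V \<and> V \<subseteq> K"
    using chart(1) by (auto simp: compactin_subtopology openin_open_subtopology)
qed

lemma measurable_of_continuous_map: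
  assumes "continuous_map Y X h" "sets M = sets (sigma (topspace X) {U. openin X U})"
    and "space N = topspace Y" "\<And>U. openin Y U \<Longrightarrow> U \<in> sets N"
  shows "h \<in> measurable N M"
proof -
  have "h \<in> measurable N (sigma (topspace X) {U. openin X U})"
  proof (rule measurable_measure_of)
    show "{U. openin X U} \<subseteq> Pow (topspace X)" using openin_subset by blast
    show "h \<in> space N \<rightarrow> topspace X" using assms(1,3) by (simp add: continuous_map_def)
    fix U assume "U \<in> {U. openin X U}"
    then have "{x \<in> topspace Y. h x \<in> U} \<in> sets N"
      using assms(1,4) by (simp add: continuous_map_def)
    moreover have "h -` U \<inter> space N = {x \<in> topspace Y. h x \<in> U}" using assms(3) by auto
    ultimately show "h -` U \<inter> space N \<in> sets N" by simp
  qed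
  then show ?thesis using measurable_cong_sets[OF refl assms(2)] by blast
qed

text \<open>
  In general the Borel sets of a product are more than the product \<open>\<sigma>\<close>-algebra; a countable base
  makes an open set a countable union of open rectangles.
\<close>

lemma openin_prod_sets_pair_measure:
  assumes "second_countable X" and open_sets: "\<And>U. openin X U \<Longrightarrow> U \<in> sets M"
    and W: "openin (prod_topology X X) W"
  shows "W \<in> sets (M \<Otimes>\<^sub>M M)"
proof -
  obtain B where B: "countable B" "\<forall>V\<in>B. openin X V"
      "\<forall>U x. openin X U \<and> x \<in> U \<longrightarrow> (\<exists>V\<in>B. x \<in> V \<and> V \<subseteq> U)"
    using assms(1) unfolding second_countable_def by (elim exE conjE)
  define R where "R = {(V1, V2) \<in> B \<times> B. V1 \<times> V2 \<subseteq> W}"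
  have "W \<subseteq> (\<Union>(V1, V2)\<in>R. V1 \<times> V2)"
  proof clarify
    fix x y assume xy: "(x, y) \<in> W"
    have "\<exists>U1 U2. openin X U1 \<and> openin X U2 \<and> x \<in> U1 \<and> y \<in> U2 \<and> U1 \<times> U2 \<subseteq> W"
      using W xy by (simp add: openin_prod_topology_alt)
    then obtain U1 U2 where U: "openin X U1" "openin X U2" "x \<in> U1" "y \<in> U2" "U1 \<times> U2 \<subseteq> W"
      by (elim exE conjE)
    obtain V1 where V1: "V1 \<in> B" "x \<in> V1" "V1 \<subseteq> U1"
      using B(3)[rule_format, OF conjI, OF U(1,3)] by (elim bexE conjE)
    obtain V2 where V2: "V2 \<in> B" "y \<in> V2" "V2 \<subseteq> U2"
      using B(3)[rule_format, OF conjI, OF U(2,4)] by (elim bexE conjE)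
    have "V1 \<times> V2 \<subseteq> W" using Sigma_mono[OF V1(3) V2(3)] U(5) by (rule subset_trans)
    with V1 V2 have "(V1, V2) \<in> R" by (simp add: R_def)
    with V1(2) V2(2) show "(x, y) \<in> (\<Union>(V1, V2)\<in>R. V1 \<times> V2)" by blast
  qed
  moreover have "(\<Union>(V1, V2)\<in>R. V1 \<times> V2) \<subseteq> W" by (auto simp: R_def)
  ultimately have W_eq: "W = (\<Union>(V1, V2)\<in>R. V1 \<times> V2)" by (rule subset_antisym)
  have "countable R"
    by (rule countable_subset[of _ "B \<times> B"]) (auto simp: R_def B(1))
  moreover have "(case V of (V1, V2) \<Rightarrow> V1 \<times> V2) \<in> sets (M \<Otimes>\<^sub>M M)" if "V \<in> R" for V
    using that B(2) open_sets by (auto simp: R_def)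
  ultimately show ?thesis unfolding W_eq by (intro sets.countable_UN' image_subsetI)
qed

text \<open>
  Each point has a neighbourhood inside a compact set, hence one of finite measure, and this may be
  taken from a countable base.
\<close>

lemma sigma_finite_of_locally_compact:
  assumes "Hausdorff_space X" "second_countable X" "locally_compact_space X"
    and sets_M: "sets M = sets (sigma (topspace X) {U. openin X U})"
    and finite_compact: "\<And>K. compactin X K \<Longrightarrow> emeasure M K < \<infinity>"
  shows "sigma_finite_measure M"
proof
  have space_M: "space M = topspace X" using sets_eq_imp_space_eq[OF sets_M] openin_subset[of X]
    by (auto simp: space_measure_of_conv)
  have open_sets: "U \<in> sets M" if "openin X U" for U
    unfolding sets_M using that openin_subset[of X] by (subst sets_measure_of) auto
  obtain B where B: "countable B" "\<forall>V\<in>B. openin X V"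
      "\<forall>U x. openin X U \<and> x \<in> U \<longrightarrow> (\<exists>V\<in>B. x \<in> V \<and> V \<subseteq> U)"
    using assms(2) unfolding second_countable_def by (elim exE conjE)
  define C where "C = {V \<in> B. emeasure M V \<noteq> \<infinity>}"
  have "x \<in> \<Union>C" if x: "x \<in> topspace X" for x
  proof -
    obtain U K where UK: "openin X U" "compactin X K" "x \<in> U" "U \<subseteq> K"
      using assms(3) x unfolding locally_compact_space_def by metis
    then obtain V where V: "V \<in> B" "x \<in> V" "V \<subseteq> U" using B(3) by metis
    have "topspace X - (topspace X - K) = K" using compactin_subset_topspace[OF UK(2)] by blast
    moreover have "topspace X - (topspace X - K) \<in> sets M"
      using compactin_imp_closedin[OF assms(1) UK(2)] open_sets space_M
      by (metis closedin_def sets.compl_sets)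
    ultimately have "emeasure M V \<le> emeasure M K" using V UK by (intro emeasure_mono) auto
    with finite_compact[OF UK(2)] V show ?thesis by (auto simp: C_def)
  qed
  moreover have "\<Union>C \<subseteq> topspace X" using B(2) openin_subset[of X] by (auto simp: C_def)
  ultimately have "\<Union>C = space M" using space_M by auto
  moreover have "countable C" using B(1) by (auto simp: C_def)
  moreover have "C \<subseteq> sets M" using B(2) open_sets by (auto simp: C_def)
  moreover have "\<forall>V\<in>C. emeasure M V \<noteq> \<infinity>" by (simp add: C_def)
  ultimately show "\<exists>C. countable C \<and> C \<subseteq> sets M \<and> \<Union>C = space M \<and> (\<forall>V\<in>C. emeasure M V \<noteq> \<infinity>)"
    by blast
qed

lemma lie_group_left_invariant_measure:
  assumes lie: "lie_group G X n A" and haar: "left_haar_measure G X M"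
  shows "left_invariant_measure G M"
proof -
  have top: "topspace X = carrier G" and manifold: "smooth_manifold X n A"
    and cont_mult: "continuous_map (prod_topology X X) X (\<lambda>(x, y). x \<otimes>\<^bsub>G\<^esub> y)"
    and cont_inv: "continuous_map X X (\<lambda>x. inv\<^bsub>G\<^esub> x)"
    using lie by (auto simp: lie_group_def smooth_map_def)
  have hausdorff: "Hausdorff_space X" and countable: "second_countable X"
    using manifold by (auto simp: smooth_manifold_def)
  have sets_M: "sets M = sets (sigma (topspace X) {U. openin X U})"
    using haar by (simp add: left_haar_measure_def)
  have space_M: "space M = topspace X" using sets_eq_imp_space_eq[OF sets_M] openin_subset[of X]
    by (auto simp: space_measure_of_conv)
  have open_sets: "U \<in> sets M" if "openin X U" for U
    unfolding sets_M using that openin_subset[of X] by (subst sets_measure_of) auto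
  interpret group G using lie by (simp add: lie_group_def)
  interpret sigma_finite_measure M
    using haar smooth_manifold_locally_compact[OF manifold]
    by (intro sigma_finite_of_locally_compact[OF hausdorff countable _ sets_M])
      (auto simp: left_haar_measure_def)
  show ?thesis
  proof
    show "space M = carrier G" using space_M top by simp
    show "(\<lambda>(x, y). x \<otimes>\<^bsub>G\<^esub> y) \<in> measurable (M \<Otimes>\<^sub>M M) M"
      using openin_prod_sets_pair_measure[OF countable open_sets]
      by (intro measurable_of_continuous_map[OF cont_mult sets_M]) (auto simp: space_pair_measure space_M)
    show "(\<lambda>x. inv\<^bsub>G\<^esub> x) \<in> measurable M M"
      using open_sets by (intro measurable_of_continuous_map[OF cont_inv sets_M]) (auto simp: space_M)
  qed (use haar in \<open>auto simp: left_haar_measure_def\<close>)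
qed

theorem mainTheorem15:
  fixes G :: "('a, 'b) monoid_scheme"
    and X :: "'a topology" and n :: nat and A :: "'a chart set"
    and M :: "'a measure" and \<Delta> :: "'a \<Rightarrow> real"
    and p :: real and f g :: "'a \<Rightarrow> complex"
  assumes "lie_group G X n A"
    and "left_haar_measure G X M"
    and "modular_function G M \<Delta>"
    and "1 \<le> p"
    and "f \<in> Lp_space M p" and "g \<in> Lp_space M p"
  shows "(\<integral>\<^sup>+(x, y). ennreal (cmod (g (inv\<^bsub>G\<^esub> x \<otimes>\<^bsub>G\<^esub> y) * f x
                                  - g (inv\<^bsub>G\<^esub> y \<otimes>\<^bsub>G\<^esub> x) * f y) powr p) \<partial>(M \<Otimes>\<^sub>M M))
       \<ge> (\<integral>\<^sup>+y. ennreal (\<bar>cmod (g y) - \<Delta> y powr (- 1 / p) * cmod (g (inv\<^bsub>G\<^esub> y))\<bar> powr p) \<partial>M)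
         * (\<integral>\<^sup>+x. ennreal (cmod (f x) powr p) \<partial>M)"
proof -
  interpret left_invariant_measure G M
    using assms(1,2) by (rule lie_group_left_invariant_measure)
  show ?thesis
    using assms(3-6) by (intro twisted_commutator_lower_bound) (auto simp: Lp_space_def)
qed

end
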